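(* Let $(E,r)$ be a $q$-matroid and let $\mathcal{Z}$ be a lattice (under inclusion) of subspaces of $E$ satisfying (Z1) $r(0_{\mathcal{Z}})=0$; (Z2) for all $F,G\in\mathcal{Z}$ with $G<F$: $0<r(F)-r(G)<\dim F-\dim G$; (Z3) for all $F,G\in\mathcal{Z}$: $r(F)+r(G)\ge r(F\vee G)+r(F\wedge G)+\dim((F\cap G)/(F\wedge G))$, where $\vee,\wedge,0_{\mathcal{Z}}$ are the join, meet and least element of $\mathcal{Z}$. Define $r_{\mathcal{Z}}(A)=\min\{r(F)+\dim((A+F)/F): F\in\mathcal{Z}\}$ for $A\le E$. Then the set of cyclic flats of the $q$-matroid $M_{\mathcal{Z}}=(E,r_{\mathcal{Z}})$ is exactly $\mathcal{Z}$.
   Context: $q$ is a prime power and $E$ an $n$-dimensional $\mathbb{F}_q$-vector space. A $q$-matroid $(E,\rho)$ is a function $\rho$ from subspaces of $E$ to $\mathbb{Z}$ with $0\le\rho(A)\le\dim A$, $\rho(A)\le\rho(B)$ for $A\le B$, and $\rho(A+B)+\rho(A\cap B)\le\rho(A)+\rho(B)$. With respect to $\rho$, a flat is a subspace $F$ with $\rho(F+x)>\rho(F)$ for all $1$-dimensional $x\not\le F$; a subspace $A$ is cyclic if $\rho(B)=\rho(A)$ for every $B\le A$ of codimension $1$ in $A$; a cyclic flat is a subspace that is both. *)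

theory Defs
  imports Complex_Main "HOL-Library.Cardinality" "HOL-Library.Set_Algebras" "HOL-Algebra.Lattice"
begin

text \<open>
  The ambient space \<open>E\<close> is the whole type carrying the scalar multiplication \<open>scale\<close>.  The ground
  field is \<open>\<bbbF>\<^sub>q\<close> once the scalar type is of class \<open>{field, finite}\<close>, with \<open>q\<close> its cardinality; the
  definitions themselves make sense over every field.  Rank functions are total on sets, but only
  their values on subspaces matter.  Sums of subspaces are the elementwise sums of
  \<open>HOL-Library.Set_Algebras\<close>.
\<close>

definition q_matroid :: "('a::field \<Rightarrow> 'b::ab_group_add \<Rightarrow> 'b) \<Rightarrow> ('b set \<Rightarrow> int) \<Rightarrow> bool" where
  "q_matroid scale \<rho> \<longleftrightarrow>
     (\<forall>A. module.subspace scale A \<longrightarrow> 0 \<le> \<rho> A \<and> \<rho> A \<le> int (vector_space.dim scale A)) \<and>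
     (\<forall>A B. module.subspace scale A \<longrightarrow> module.subspace scale B \<longrightarrow> A \<subseteq> B \<longrightarrow> \<rho> A \<le> \<rho> B) \<and>
     (\<forall>A B. module.subspace scale A \<longrightarrow> module.subspace scale B \<longrightarrow>
        \<rho> (A + B) + \<rho> (A \<inter> B) \<le> \<rho> A + \<rho> B)"

definition flat ::
  "('a::field \<Rightarrow> 'b::ab_group_add \<Rightarrow> 'b) \<Rightarrow> ('b set \<Rightarrow> int) \<Rightarrow> 'b set \<Rightarrow> bool" where
  "flat scale \<rho> F \<longleftrightarrow> module.subspace scale F \<and>
     (\<forall>X. module.subspace scale X \<longrightarrow> vector_space.dim scale X = 1 \<longrightarrow> \<not> X \<subseteq> F \<longrightarrow>
        \<rho> (F + X) > \<rho> F)"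

definition cyclic ::
  "('a::field \<Rightarrow> 'b::ab_group_add \<Rightarrow> 'b) \<Rightarrow> ('b set \<Rightarrow> int) \<Rightarrow> 'b set \<Rightarrow> bool" where
  "cyclic scale \<rho> A \<longleftrightarrow> module.subspace scale A \<and>
     (\<forall>B. module.subspace scale B \<longrightarrow> B \<subseteq> A \<longrightarrow>
        vector_space.dim scale A = vector_space.dim scale B + 1 \<longrightarrow> \<rho> B = \<rho> A)"

definition cyclic_flats ::
  "('a::field \<Rightarrow> 'b::ab_group_add \<Rightarrow> 'b) \<Rightarrow> ('b set \<Rightarrow> int) \<Rightarrow> 'b set set" where
  "cyclic_flats scale \<rho> = {A. flat scale \<rho> A \<and> cyclic scale \<rho> A}"

text \<open>
  The dimension of the quotient \<open>A/F\<close>, meaningful for subspaces \<open>F \<subseteq> A\<close> of a finite-dimensional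
  space.  The lemma \<open>card_cosets_quotient_dim\<close> below confirms that over a field with \<open>q\<close> elements
  the quotient, as a set of cosets, has \<open>q\<close> to this power many elements.
\<close>

definition quotient_dim ::
  "('a::field \<Rightarrow> 'b::ab_group_add \<Rightarrow> 'b) \<Rightarrow> 'b set \<Rightarrow> 'b set \<Rightarrow> int" where
  "quotient_dim scale A F = int (vector_space.dim scale A) - int (vector_space.dim scale F)"

text \<open>
  \<open>Min\<close> is unspecified on infinite and empty sets; a nonempty family of subspaces of a
  finite-dimensional space over a finite field is neither.
\<close>

definition lattice_rank ::
  "('a::field \<Rightarrow> 'b::ab_group_add \<Rightarrow> 'b) \<Rightarrow> 'b set set \<Rightarrow> ('b set \<Rightarrow> int) \<Rightarrow> 'b set \<Rightarrow> int" where
  "lattice_rank scale Z r A = Min ((\<lambda>F. r F + quotient_dim scale (A + F) F) ` Z)"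

text \<open>A family of sets as an order in the sense of \<open>HOL-Algebra\<close>.\<close>

abbreviation inclusion_order :: "'b set set \<Rightarrow> 'b set gorder" where
  "inclusion_order Z \<equiv> \<lparr>carrier = Z, eq = (=), le = (\<subseteq>)\<rparr>"

lemma card_subspace_finite_field:
  fixes scale :: "'a::{field,finite} \<Rightarrow> 'b::ab_group_add \<Rightarrow> 'b"
  assumes "finite_dimensional_vector_space scale Basis"
    and S: "module.subspace scale S"
  shows "card S = CARD('a) ^ vector_space.dim scale S" and "finite S"
proof -
  interpret finite_dimensional_vector_space scale Basis by fact
  obtain B where B: "B \<subseteq> S" "independent B" "S \<subseteq> span B" "card B = dim S"
    by (rule basis_exists)
  have fin: "finite B" using B(2) by (rule finiteI_independent)
  have spanB: "span B = S" using B S by (simp add: span_minimal subset_antisym)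
  define f where "f u = (\<Sum>v\<in>B. scale (u v) v)" for u
  have "f ` (B \<rightarrow>\<^sub>E UNIV) = S"
  proof -
    have "f u \<in> f ` (B \<rightarrow>\<^sub>E UNIV)" for u
      by (rule image_eqI[where x = "restrict u B"]) (auto simp: f_def)
    then show ?thesis using span_finite[OF fin] spanB by (auto simp: f_def)
  qed
  moreover have "inj_on f (B \<rightarrow>\<^sub>E UNIV)"
  proof (rule inj_onI)
    fix u w assume u: "u \<in> B \<rightarrow>\<^sub>E UNIV" and w: "w \<in> B \<rightarrow>\<^sub>E UNIV" and "f u = f w"
    then have "(\<Sum>v\<in>B. scale (u v - w v) v) = 0"
      by (simp add: f_def scale_left_diff_distrib sum_subtractf)
    then have "u v - w v = 0" if "v \<in> B" for v
      using independentD[OF B(2) fin subset_refl, of "\<lambda>v. u v - w v"] that by simp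
    then show "u = w" using u w by (auto intro: PiE_ext)
  qed
  ultimately have bij: "bij_betw f (B \<rightarrow>\<^sub>E (UNIV :: 'a set)) S"
    by (simp add: bij_betw_def)
  show "card S = CARD('a) ^ dim S"
    using bij_betw_same_card[OF bij] fin B(4) by (simp add: card_PiE)
  show "finite S"
    using bij_betw_finite[OF bij] fin by (simp add: finite_PiE)
qed

lemma card_cosets_quotient_dim:
  fixes scale :: "'a::{field,finite} \<Rightarrow> 'b::ab_group_add \<Rightarrow> 'b"
  assumes fd: "finite_dimensional_vector_space scale Basis"
    and A: "module.subspace scale A" and F: "module.subspace scale F" and "F \<subseteq> A"
  shows "card ((\<lambda>a. {a} + F) ` A) = CARD('a) ^ nat (quotient_dim scale A F)"
proof -
  interpret finite_dimensional_vector_space scale Basis by fact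
  note cA = card_subspace_finite_field[OF fd A] and cF = card_subspace_finite_field[OF fd F]
  let ?C = "(\<lambda>a. {a} + F) ` A"
  have coset: "{a} + F = (+) a ` F" for a by (auto simp: set_plus_def)
  have mem: "x \<in> {a} + F \<longleftrightarrow> x - a \<in> F" for a x
    unfolding coset image_iff by (auto intro!: bexI[of _ "x - a"])
  have Un: "\<Union>?C = A"
  proof (intro equalityI subsetI)
    fix x assume "x \<in> \<Union>?C"
    then show "x \<in> A" using \<open>F \<subseteq> A\<close> A by (auto simp: coset intro: subspace_add)
  next
    fix x assume "x \<in> A"
    then show "x \<in> \<Union>?C" using subspace_0[OF F] mem[of x x] by auto
  qed
  have disj: "c \<inter> d = {}" if cd: "c \<in> ?C" "d \<in> ?C" "c \<noteq> d" for c d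
  proof (rule ccontr)
    assume "c \<inter> d \<noteq> {}"
    then obtain x a b where x: "c = {a} + F" "d = {b} + F" "x - a \<in> F" "x - b \<in> F"
      using cd mem by blast
    have ba: "b - a \<in> F" using subspace_diff[OF F x(3) x(4)] by simp
    have "y - a \<in> F \<longleftrightarrow> y - b \<in> F" for y
      using subspace_add[OF F _ ba, of "y - b"] subspace_diff[OF F _ ba, of "y - a"] by auto
    then have "c = d" using x mem by blast
    then show False using cd by simp
  qed
  have "card F * card ?C = card (\<Union>?C)"
  proof (rule card_partition)
    show "finite ?C" "finite (\<Union>?C)" using cA Un by simp_all
    show "card c = card F" if "c \<in> ?C" for c
      using that by (auto simp: coset intro!: card_image inj_onI)
  qed (use disj in blast)
  moreover have "dim A = dim F + nat (quotient_dim scale A F)"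
    using dim_subset[OF \<open>F \<subseteq> A\<close>] by (simp add: quotient_dim_def)
  ultimately show ?thesis using cA cF Un by (simp add: power_add)
qed

end

theory Submission
  imports Defs
begin

text \<open>
  Write \<open>g F A = r F + dim ((A + F)/F)\<close> for the quantity that \<open>r\<^sub>Z A\<close> minimises over \<open>F\<close>.  By (Z3)
  and the modularity of dimension, \<open>g (F \<or> G) (A + B) + g (F \<and> G) (A \<inter> B) \<le> g F A + g G B\<close>, which
  makes \<open>r\<^sub>Z\<close> submodular.  By (Z2) and (Z3), \<open>g G F > r F\<close> for distinct \<open>F\<close>, \<open>G\<close> in \<open>Z\<close>, so \<open>F\<close> is
  the strict minimiser at \<open>F\<close>.  Since \<open>g G\<close> is monotone and drops by at most \<open>1\<close> from a subspace to
  one of codimension \<open>1\<close>, every \<open>F\<close> in \<open>Z\<close> is a cyclic flat.  Conversely, if \<open>F\<close> attains the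
  minimum at a cyclic flat \<open>A\<close>, then \<open>F \<subseteq> A\<close> because \<open>A\<close> is flat, as adjoining a vector of \<open>F\<close> to
  \<open>A\<close> does not change \<open>g F A\<close>; and \<open>F = A\<close> because \<open>A\<close> is cyclic, as \<open>g F\<close> drops on a
  codimension-\<open>1\<close> subspace of \<open>A\<close> that contains \<open>F\<close>.
\<close>

section \<open>Sums, dimensions and codimension-1 subspaces\<close>

context finite_dimensional_vector_space
begin

lemma subspace_set_plus: "subspace (A + B)" if "subspace A" "subspace B"
proof -
  have "A + B = {x + y |x y. x \<in> A \<and> y \<in> B}" by (auto simp: set_plus_def)
  then show ?thesis using subspace_sums[OF that] by simp
qed

lemma set_plus_upper1: "A \<subseteq> A + B" if "subspace B" for A B :: "'b set"
  using subspace_0[OF that] by (force simp: set_plus_def)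

lemma set_plus_upper2: "B \<subseteq> A + B" if "subspace A" for A B :: "'b set"
  using subspace_0[OF that] by (force simp: set_plus_def)

lemma set_plus_least: "A + B \<subseteq> C" if "subspace C" "A \<subseteq> C" "B \<subseteq> C" for A B :: "'b set"
  using that subspace_add by (fastforce simp: set_plus_def)

lemma dim_set_plus_Int: "dim (A + B) + dim (A \<inter> B) = dim A + dim B"
  if "subspace A" "subspace B"
proof -
  have "A + B = {x + y |x y. x \<in> A \<and> y \<in> B}" by (auto simp: set_plus_def)
  then show ?thesis using dim_sums_Int[OF that] by simp
qed

lemma dim_span_insert:
  assumes "subspace A" "x \<notin> A"
  shows "dim (span (insert x A)) = dim A + 1"
  using assms by (simp add: dim_insert span_eq_iff[THEN iffD2])

text \<open>Take \<open>B\<close> of largest dimension among the subspaces between \<open>F\<close>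
  and \<open>A\<close> other than \<open>A\<close>: adjoining any vector of \<open>A\<close> outside
  \<open>B\<close> must then give all of \<open>A\<close>.\<close>

lemma exists_codim_1_subspace:
  assumes A: "subspace A" and F: "subspace F" and "F \<subset> A"
  obtains B where "subspace B" "F \<subseteq> B" "B \<subseteq> A" "dim A = dim B + 1"
proof -
  define P where "P B \<longleftrightarrow> subspace B \<and> F \<subseteq> B \<and> B \<subset> A" for B
  have "P F" using F \<open>F \<subset> A\<close> by (simp add: P_def)
  moreover have "\<forall>B. P B \<longrightarrow> dim B < Suc (dim A)"
    by (auto simp: P_def less_Suc_eq_le intro: dim_subset)
  ultimately obtain B where B: "P B" and max: "\<And>C. P C \<Longrightarrow> dim C \<le> dim B"
    using ex_has_greatest_nat[of P F dim "Suc (dim A)"] by auto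
  obtain x where x: "x \<in> A" "x \<notin> B" using B by (auto simp: P_def)
  let ?C = "span (insert x B)"
  have dC: "dim ?C = dim B + 1" using dim_span_insert B x by (simp add: P_def)
  have "?C \<subseteq> A" using B x A by (intro span_minimal) (auto simp: P_def)
  moreover have "F \<subseteq> ?C" using B by (auto simp: P_def intro: span_base)
  ultimately have "?C = A" using max[of ?C] dC by (auto simp: P_def)
  then show ?thesis using that[of B] B dC by (auto simp: P_def)
qed

end

text \<open>Join and meet enter as plain operations with the bounds that the estimates use, and
  finiteness of \<open>Z\<close> makes the minimum defining \<open>lattice_rank\<close> an attained
  one.\<close>

locale weighted_subspace_lattice = finite_dimensional_vector_space scale Basis
  for scale :: "'a::field \<Rightarrow> 'b::ab_group_add \<Rightarrow> 'b" and Basis +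
  fixes Z :: "'b set set" and r :: "'b set \<Rightarrow> int" and join meet :: "'b set \<Rightarrow> 'b set \<Rightarrow> 'b set"
    and bot :: "'b set"
  assumes finite_Z: "finite Z"
    and subspace_Z: "F \<in> Z \<Longrightarrow> subspace F"
    and join: "F \<in> Z \<Longrightarrow> G \<in> Z \<Longrightarrow> join F G \<in> Z \<and> F \<subseteq> join F G \<and> G \<subseteq> join F G"
    and meet: "F \<in> Z \<Longrightarrow> G \<in> Z \<Longrightarrow> meet F G \<in> Z \<and> meet F G \<subseteq> F \<and> meet F G \<subseteq> G"
    and r_nonneg: "F \<in> Z \<Longrightarrow> 0 \<le> r F"
    and bot: "bot \<in> Z" "r bot = 0"
    and r_strict: "F \<in> Z \<Longrightarrow> G \<in> Z \<Longrightarrow> G \<subset> F \<Longrightarrow>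
      0 < r F - r G \<and> r F - r G < int (dim F) - int (dim G)"
    and r_submodular: "F \<in> Z \<Longrightarrow> G \<in> Z \<Longrightarrow>
      r (join F G) + r (meet F G) + (int (dim (F \<inter> G)) - int (dim (meet F G))) \<le> r F + r G"
begin

section \<open>The quantity \<open>g F A\<close> and the q-matroid axioms for its minimum over
  \<open>F\<close>\<close>

definition g :: "'b set \<Rightarrow> 'b set \<Rightarrow> int" where
  "g F A = r F + int (dim (A + F)) - int (dim F)"

abbreviation rZ :: "'b set \<Rightarrow> int" where "rZ \<equiv> lattice_rank scale Z r"

lemma rZ_eq: "rZ A = Min ((\<lambda>F. g F A) ` Z)"
  unfolding lattice_rank_def g_def quotient_dim_def by (simp add: algebra_simps)

lemma rZ_le: "F \<in> Z \<Longrightarrow> rZ A \<le> g F A"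
  unfolding rZ_eq using finite_Z by simp

lemma rZ_attained:
  obtains F where "F \<in> Z" "rZ A = g F A"
proof -
  have "Min ((\<lambda>F. g F A) ` Z) \<in> (\<lambda>F. g F A) ` Z"
    using finite_Z bot(1) by (intro Min_in) auto
  then show ?thesis using that unfolding rZ_eq by auto
qed

text \<open>By modularity \<open>(A + F)/F\<close> and \<open>A/(A \<inter> F)\<close> have the same
  dimension; the second form suits comparing \<open>g F\<close> on nested subspaces.\<close>

lemma g_alt: "g F A = r F + int (dim A) - int (dim (A \<inter> F))" if "F \<in> Z" "subspace A"
  using dim_set_plus_Int[OF that(2) subspace_Z[OF that(1)]] by (simp add: g_def)

lemma g_mono: "A \<subseteq> B \<Longrightarrow> g F A \<le> g F B"
  using dim_subset[OF set_plus_mono2[of A B F F]] by (simp add: g_def)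

lemma r_mono: "F \<in> Z \<Longrightarrow> G \<in> Z \<Longrightarrow> G \<subseteq> F \<Longrightarrow> r G \<le> r F"
  using r_strict[of F G] by (cases "G = F") (auto simp: psubset_eq)

lemma g_submodular:
  assumes A: "subspace A" and B: "subspace B" and F: "F \<in> Z" and G: "G \<in> Z"
  shows "g (join F G) (A + B) + g (meet F G) (A \<inter> B) \<le> g F A + g G B"
proof -
  let ?J = "join F G" and ?M = "meet F G"
  note sF = subspace_Z[OF F] and sG = subspace_Z[OF G]
  note J = join[OF F G] and M = meet[OF F G]
  note sJ = subspace_Z[OF J[THEN conjunct1]]
  note sAB = subspace_set_plus[OF A B] and sFG = subspace_set_plus[OF sF sG]
  note sAF = subspace_set_plus[OF A sF] and sBG = subspace_set_plus[OF B sG]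
  have J': "F + G \<subseteq> ?J" using J sJ by (intro set_plus_least) auto
  \<comment> \<open>Enlarging \<open>F + G\<close> to \<open>?J\<close> can only shrink the
    quotient, since \<open>A + B\<close> meets \<open>?J\<close> in at least as much.\<close>
  have 1: "int (dim (A + B + ?J)) - int (dim ?J)
      \<le> int (dim (A + F + (B + G))) - int (dim (F + G))"
  proof -
    have "dim ((A + B) \<inter> (F + G)) \<le> dim ((A + B) \<inter> ?J)"
      using J' by (intro dim_subset) auto
    then show ?thesis
      using dim_set_plus_Int[OF sAB sJ] dim_set_plus_Int[OF sAB sFG]
      by (simp add: algebra_simps)
  qed
  have 2: "dim (A \<inter> B + ?M) \<le> dim ((A + F) \<inter> (B + G))"
  proof (intro dim_subset set_plus_least subspace_inter sAF sBG)
    show "A \<inter> B \<subseteq> (A + F) \<inter> (B + G)"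
      using set_plus_upper1[OF sF] set_plus_upper1[OF sG] by blast
    show "?M \<subseteq> (A + F) \<inter> (B + G)"
      using set_plus_upper2[OF A] set_plus_upper2[OF B] M by blast
  qed
  show ?thesis
    \<comment> \<open>Modularity for \<open>A + F\<close>, \<open>B + G\<close> and for
      \<open>F\<close>, \<open>G\<close> leaves the excess
      \<open>dim (F \<inter> G) - dim ?M\<close>, which is exactly the last term of (Z3).\<close>
    using 1 2 r_submodular[OF F G] dim_set_plus_Int[OF sF sG] dim_set_plus_Int[OF sAF sBG]
    by (simp add: g_def)
qed

lemma q_matroid_rZ: "q_matroid scale rZ"
  unfolding q_matroid_def
proof (intro conjI allI impI)
  fix A assume A: "subspace A"
  obtain F where F: "F \<in> Z" "rZ A = g F A" by (rule rZ_attained)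
  have "dim F \<le> dim (A + F)" by (intro dim_subset set_plus_upper2 A)
  then show "0 \<le> rZ A" using F(2) r_nonneg[OF F(1)] by (simp add: g_def)
  \<comment> \<open>(Z1) enters here: since \<open>r bot = 0\<close>, the value
    \<open>g bot A\<close> is \<open>dim A - dim (A \<inter> bot)\<close>.\<close>
  show "rZ A \<le> int (dim A)"
    using rZ_le[OF bot(1), of A] g_alt[OF bot(1) A] bot(2) by simp
next
  fix A B :: "'b set" assume "A \<subseteq> B"
  obtain F where F: "F \<in> Z" "rZ B = g F B" by (rule rZ_attained)
  then show "rZ A \<le> rZ B" using rZ_le[OF F(1), of A] g_mono[OF \<open>A \<subseteq> B\<close>, of F] by simp
next
  fix A B assume A: "subspace A" and B: "subspace B"
  obtain F where F: "F \<in> Z" "rZ A = g F A" by (rule rZ_attained)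
  obtain G where G: "G \<in> Z" "rZ B = g G B" by (rule rZ_attained)
  show "rZ (A + B) + rZ (A \<inter> B) \<le> rZ A + rZ B"
    using g_submodular[OF A B F(1) G(1)] rZ_le[of "join F G" "A + B"] rZ_le[of "meet F G" "A \<inter> B"]
      join[OF F(1) G(1)] meet[OF F(1) G(1)] F G by simp
qed

section \<open>Strict minimality at members of \<open>Z\<close>, and the cyclic flats\<close>

text \<open>(Z3) gives \<open>g G F - r F \<ge> (r ?J - r F) + ((dim F - dim ?M) - (r F - r
  ?M))\<close>. Both summands are nonnegative by (Z2), and they cannot both vanish.\<close>

lemma g_gt:
  assumes F: "F \<in> Z" and G: "G \<in> Z" and "F \<noteq> G"
  shows "r F < g G F"
proof -
  let ?J = "join F G" and ?M = "meet F G"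
  note J = join[OF F G] and M = meet[OF F G]
  have 1: "r F \<le> r ?J" using r_mono[of ?J F] J F by simp
  have 2: "r F - r ?M \<le> int (dim F) - int (dim ?M)"
    using r_strict[of F ?M] M F by (cases "?M = F") (auto simp: psubset_eq)
  have "r F < r ?J \<or> r F - r ?M < int (dim F) - int (dim ?M)"
  proof (cases "?J = F")
    case True
    \<comment> \<open>Here \<open>G\<close> lies properly inside \<open>F\<close>, and
      \<open>?M\<close> lies inside \<open>G\<close>.\<close>
    then have "?M \<subset> F" using J M \<open>F \<noteq> G\<close> by auto
    then show ?thesis using r_strict[of F ?M] M F by simp
  next
    case False
    then have "F \<subset> ?J" using J by auto
    then show ?thesis using r_strict[of ?J F] J F by simp
  qed
  then show ?thesis
    using 1 2 r_submodular[OF F G] g_alt[OF G subspace_Z[OF F]] by linarith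
qed

lemma g_self: "F \<in> Z \<Longrightarrow> g F F = r F"
  using g_alt[of F F] subspace_Z by simp

lemma rZ_eq_r: "rZ F = r F" if F: "F \<in> Z"
proof -
  obtain G where "G \<in> Z" "rZ F = g G F" by (rule rZ_attained)
  then have "r F \<le> rZ F" using g_gt[OF F, of G] g_self[OF F] by (cases "F = G") auto
  then show ?thesis using rZ_le[OF F, of F] g_self[OF F] by simp
qed

lemma flat_rZ:
  assumes F: "F \<in> Z"
  shows "flat scale rZ F"
  unfolding flat_def
proof (intro conjI allI impI)
  note sF = subspace_Z[OF F]
  show "subspace F" by (fact sF)
  fix X assume X: "subspace X" "\<not> X \<subseteq> F"
  have sub: "F \<subseteq> F + X" by (rule set_plus_upper1[OF X(1)])
  obtain G where G: "G \<in> Z" "rZ (F + X) = g G (F + X)" by (rule rZ_attained)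
  have "r F < g G (F + X)"
  proof (cases "F = G")
    case True
    have "F \<subset> F + X" using sub set_plus_upper2[OF sF, of X] X(2) by blast
    then have "dim F < dim (F + X)"
      using sF subspace_set_plus[OF sF X(1)] by (intro dim_psubset) (simp add: span_eq_iff[THEN iffD2])
    also have "\<dots> \<le> dim (F + X + F)" by (intro dim_subset set_plus_upper1 sF)
    finally show ?thesis using True by (simp add: g_def)
  next
    case False
    then show ?thesis using g_gt[OF F G(1)] g_mono[OF sub, of G] by simp
  qed
  then show "rZ F < rZ (F + X)" using G rZ_eq_r[OF F] by simp
qed

lemma cyclic_rZ:
  assumes F: "F \<in> Z"
  shows "cyclic scale rZ F"
  unfolding cyclic_def
proof (intro conjI allI impI)
  note sF = subspace_Z[OF F]
  show "subspace F" by (fact sF)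
  fix B assume B: "subspace B" "B \<subseteq> F" "dim F = dim B + 1"
  obtain G where G: "G \<in> Z" "rZ B = g G B" by (rule rZ_attained)
  have "r F \<le> g G B"
  proof (cases "F = G")
    case True
    then show ?thesis using g_alt[OF F B(1)] B(2) by (simp add: Int_absorb2)
  next
    case False
    have "dim (B \<inter> G) \<le> dim (F \<inter> G)" using B by (intro dim_subset) auto
    \<comment> \<open>Passing from \<open>F\<close> to \<open>B\<close> costs at most
      \<open>dim F - dim B = 1\<close>; as values are integers, the strict bound
      \<open>r F < g G F\<close> absorbs this loss.\<close>
    then have "g G F - 1 \<le> g G B"
      using g_alt[OF G(1) sF] g_alt[OF G(1) B(1)] B(3) by simp
    then show ?thesis using g_gt[OF F G(1) False] by simp
  qed
  moreover have "rZ B \<le> r F"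
    using rZ_le[OF F, of B] g_mono[OF B(2), of F] g_self[OF F] by simp
  ultimately show "rZ B = rZ F" using G rZ_eq_r[OF F] by simp
qed

lemma cyclic_flat_in_Z:
  assumes fl: "flat scale rZ A" and cy: "cyclic scale rZ A"
  shows "A \<in> Z"
proof -
  have A: "subspace A" using fl by (simp add: flat_def)
  obtain F where F: "F \<in> Z" "rZ A = g F A" by (rule rZ_attained)
  note sF = subspace_Z[OF F(1)]
  have "F \<subseteq> A"
  proof (rule ccontr)
    assume "\<not> F \<subseteq> A"
    then obtain x where x: "x \<in> F" "x \<notin> A" by blast
    let ?X = "span {x}"
    have "x \<noteq> 0" using x(2) subspace_0[OF A] by auto
    then have "dim ?X = 1" by (simp add: dim_insert)
    moreover have "\<not> ?X \<subseteq> A" using x(2) span_base[of x "{x}"] by auto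
    ultimately have "rZ A < rZ (A + ?X)" using fl by (simp add: flat_def)
    also have "\<dots> \<le> g F (A + ?X)" by (rule rZ_le[OF F(1)])
    also have "\<dots> \<le> g F A"
    proof -
      have "?X \<subseteq> F" using x(1) sF by (intro span_minimal) auto
      then have "A + ?X + F \<subseteq> A + F"
        using set_plus_upper1[OF sF, of A] set_plus_upper2[OF A, of F]
        by (intro set_plus_least subspace_set_plus A sF) auto
      then show ?thesis using dim_subset by (simp add: g_def)
    qed
    finally show False using F(2) by simp
  qed
  show ?thesis
  proof (cases "F = A")
    case False
    then obtain B where B: "subspace B" "F \<subseteq> B" "B \<subseteq> A" "dim A = dim B + 1"
      using exists_codim_1_subspace[OF A sF] \<open>F \<subseteq> A\<close> by blast
    \<comment> \<open>Both \<open>A\<close> and \<open>B\<close> meet \<open>F\<close> in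
      \<open>F\<close> itself, so \<open>g F\<close> drops by the full codimension 1.\<close>
    have "g F B < g F A"
      using g_alt[OF F(1) A] g_alt[OF F(1) B(1)] B \<open>F \<subseteq> A\<close> by (simp add: Int_absorb1)
    moreover have "rZ B = rZ A" using cy B by (simp add: cyclic_def)
    ultimately show ?thesis using rZ_le[OF F(1), of B] F(2) by simp
  qed (use F in simp)
qed

lemma cyclic_flats_rZ: "cyclic_flats scale rZ = Z"
  using flat_rZ cyclic_rZ cyclic_flat_in_Z by (auto simp: cyclic_flats_def)

end

section \<open>Finiteness of the ambient space and the least element of \<open>Z\<close>\<close>

text \<open>The bottom is a choice term, so a least element must be exhibited. A minimal
  \<open>m\<close> is one: its meet with any \<open>F\<close> lies below \<open>m\<close>, hence
  equals \<open>m\<close>, so \<open>m \<subseteq> F\<close>.\<close>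

lemma bottom_in_finite_lattice:
  fixes Z :: "'b set set"
  assumes "lattice (inclusion_order Z)" and "finite Z" "Z \<noteq> {}"
  shows "\<bottom>\<^bsub>inclusion_order Z\<^esub> \<in> Z"
proof -
  interpret L: lattice "inclusion_order Z" by fact
  obtain m where m: "m \<in> Z" "\<And>F. F \<in> Z \<Longrightarrow> F \<subseteq> m \<Longrightarrow> m = F"
    using finite_has_minimal[OF assms(2,3)] by blast
  have "m \<subseteq> F" if "F \<in> Z" for F
    using m that L.meet_left[of m F] L.meet_right[of m F] L.meet_closed[of m F] by force
  then have "least (inclusion_order Z) m Z" using m(1) by (auto simp: least_def)
  then show ?thesis unfolding bottom_def
    by (metis L.weak_least_unique least_mem partial_object.select_convs(1) someI_ex)
qed

theorem theorem3p11:
  fixes scale :: "'a::{field,finite} \<Rightarrow> 'b::ab_group_add \<Rightarrow> 'b"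
    and Basis :: "'b set" and r :: "'b set \<Rightarrow> int" and Z :: "'b set set"
  assumes "finite_dimensional_vector_space scale Basis"
    and "q_matroid scale r"
    and "Z \<noteq> {}" and "\<And>F. F \<in> Z \<Longrightarrow> module.subspace scale F"
    and "lattice (inclusion_order Z)"
    and Z1: "r \<bottom>\<^bsub>inclusion_order Z\<^esub> = 0"
    and Z2: "\<And>F G. F \<in> Z \<Longrightarrow> G \<in> Z \<Longrightarrow> G \<subset> F \<Longrightarrow>
      0 < r F - r G \<and> r F - r G < int (vector_space.dim scale F) - int (vector_space.dim scale G)"
    and Z3: "\<And>F G. F \<in> Z \<Longrightarrow> G \<in> Z \<Longrightarrow>
      r F + r G \<ge> r (F \<squnion>\<^bsub>inclusion_order Z\<^esub> G) + r (F \<sqinter>\<^bsub>inclusion_order Z\<^esub> G)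
        + quotient_dim scale (F \<inter> G) (F \<sqinter>\<^bsub>inclusion_order Z\<^esub> G)"
  shows "q_matroid scale (lattice_rank scale Z r) \<and>
    cyclic_flats scale (lattice_rank scale Z r) = Z"
proof -
  interpret finite_dimensional_vector_space scale Basis by fact
  interpret L: lattice "inclusion_order Z" by fact
  \<comment> \<open>A finite-dimensional space over a finite field is finite, so it has only
    finitely many subsets.\<close>
  have "finite (UNIV :: 'b set)"
    by (rule card_subspace_finite_field(2)[OF assms(1) subspace_UNIV])
  then have fin: "finite Z" by (metis Pow_UNIV finite_Pow_iff finite_subset subset_UNIV)
  interpret W: weighted_subspace_lattice scale Basis Z r
    "\<lambda>F G. F \<squnion>\<^bsub>inclusion_order Z\<^esub> G" "\<lambda>F G. F \<sqinter>\<^bsub>inclusion_order Z\<^esub> G" "\<bottom>\<^bsub>inclusion_order Z\<^esub>"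
  proof unfold_locales
    fix F G assume F: "F \<in> Z" and G: "G \<in> Z"
    show "F \<squnion>\<^bsub>inclusion_order Z\<^esub> G \<in> Z \<and> F \<subseteq> F \<squnion>\<^bsub>inclusion_order Z\<^esub> G
        \<and> G \<subseteq> F \<squnion>\<^bsub>inclusion_order Z\<^esub> G"
      using L.join_closed[of F G] L.join_left[of F G] L.join_right[of F G] F G by simp
    show "F \<sqinter>\<^bsub>inclusion_order Z\<^esub> G \<in> Z \<and> F \<sqinter>\<^bsub>inclusion_order Z\<^esub> G \<subseteq> F
        \<and> F \<sqinter>\<^bsub>inclusion_order Z\<^esub> G \<subseteq> G"
      using L.meet_closed[of F G] L.meet_left[of F G] L.meet_right[of F G] F G by simp
    show "0 \<le> r F" using assms(2,4) F by (simp add: q_matroid_def)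
    show "r (F \<squnion>\<^bsub>inclusion_order Z\<^esub> G) + r (F \<sqinter>\<^bsub>inclusion_order Z\<^esub> G)
        + (int (dim (F \<inter> G)) - int (dim (F \<sqinter>\<^bsub>inclusion_order Z\<^esub> G))) \<le> r F + r G"
      using Z3[OF F G] by (simp add: quotient_dim_def)
  qed (use fin assms(4) Z1 Z2 bottom_in_finite_lattice[OF assms(5) fin assms(3)] in auto)
  show ?thesis using W.q_matroid_rZ W.cyclic_flats_rZ by blast
qed

end
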